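(* Let $\alpha\in\mathbb{R}\setminus\{0\}$ and let the surface of revolution $M$ given by $$X(s,\theta)=\big(r(s)\sin\varphi(s)\cos\theta,\ r(s)\sin\varphi(s)\sin\theta,\ r(s)\cos\varphi(s)+s\big),\qquad r'(s)=-\cos\varphi(s),$$ be a $K^{\alpha}$-translator with the speed $w=(0,0,1)$. Then there is no parallel surface $M^{\lambda}$ of $M$ ($\lambda\in\mathbb{R}\setminus\{0\}$) which is a $\bar K^{\alpha}$-translator with the same speed $w$.
   Context: Here $r(s)>0$ is a smooth function on an interval, $\varphi(s)$ is a smooth function with $r'=-\cos\varphi$, the surface $M$ is regular (so $\sin\varphi\neq0$), and $\theta\in[0,2\pi)$. The unit normal is $U=(\sin\varphi\cos\theta,\sin\varphi\sin\theta,\cos\varphi)$, the shape operator is $S_p(v)=-\nabla_vU$, $K=\det S_p$ is the Gauss curvature and $H=\frac12\operatorname{trace}S_p$ the mean curvature; explicitly $K=\frac{r''}{r(rr''-1+r'^2)}$ and $H=-\frac12\left(Kr+\frac1r\right)$. For $\lambda\in\mathbb{R}\setminus\{0\}$, the parallel surface $M^{\lambda}$ at distance $\lambda$ is parametrized by $\bar X=X+\lambda U$ and is assumed regular, i.e. $1-2\lambda H+\lambda^2K\neq0$. Its unit normal is $\bar U=\varepsilon U$ with $\varepsilon$ the sign of $1-2\lambda H+\lambda^2K$, and its Gauss curvature is $\bar K=\frac{K}{1-2\lambda H+\lambda^2K}$. For a constant $\alpha\neq0$, $M$ is a $K^{\alpha}$-translator with speed the unit vector $w$ if $K^{\alpha}=\langle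 U,w\rangle$ everywhere on $M$; $M^{\lambda}$ is a $\bar K^{\alpha}$-translator with speed $w$ if $\bar K^{\alpha}=\langle\bar U,w\rangle$. By convention the Gauss curvature of a translator is nowhere zero, and the powers must be well-defined real numbers: powers of negative numbers are used only for integer exponents. *)

theory Defs
  imports "HOL-Analysis.Analysis"
begin

text \<open>Meant for open \<open>I\<close>, where the iterated \<^const>\<open>deriv\<close> only depends on the values of \<open>f\<close> on \<open>I\<close>.\<close>

definition smooth_fun_on :: "real set \<Rightarrow> (real \<Rightarrow> real) \<Rightarrow> bool" where
  "smooth_fun_on I f \<longleftrightarrow> (\<forall>n. \<forall>x\<in>I. (deriv ^^ n) f differentiable (at x))"

type_synonym surface_map = "real \<Rightarrow> real \<Rightarrow> real^3"

definition partial_s :: "surface_map \<Rightarrow> surface_map" where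
  "partial_s F s \<theta> = vector_derivative (\<lambda>t. F t \<theta>) (at s)"

definition partial_\<theta> :: "surface_map \<Rightarrow> surface_map" where
  "partial_\<theta> F s \<theta> = vector_derivative (\<lambda>t. F s t) (at \<theta>)"

definition regular_on :: "real set \<Rightarrow> surface_map \<Rightarrow> bool" where
  "regular_on I X \<longleftrightarrow>
     (\<forall>s\<in>I. \<forall>\<theta>\<in>{0..<2*pi}. cross3 (partial_s X s \<theta>) (partial_\<theta> X s \<theta>) \<noteq> 0)"

text \<open>The matrix of the shape operator \<open>S(v) = -\<nabla>\<^sub>v U\<close> of the surface \<open>X\<close> with unit normal field
  \<open>U\<close> in the basis \<open>X\<^sub>s, X\<^sub>\<theta>\<close> of the tangent plane; thus \<open>S(X\<^sub>s) = -U\<^sub>s\<close> and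
  \<open>S(X\<^sub>\<theta>) = -U\<^sub>\<theta>\<close>. It is well defined where \<open>X\<close> is regular and \<open>U\<close> is a unit normal field.\<close>

definition shape_matrix :: "surface_map \<Rightarrow> surface_map \<Rightarrow> real \<Rightarrow> real \<Rightarrow> real^2^2" where
  "shape_matrix X U s \<theta> = (THE A.
     - partial_s U s \<theta> = (A$1$1) *\<^sub>R partial_s X s \<theta> + (A$2$1) *\<^sub>R partial_\<theta> X s \<theta> \<and>
     - partial_\<theta> U s \<theta> = (A$1$2) *\<^sub>R partial_s X s \<theta> + (A$2$2) *\<^sub>R partial_\<theta> X s \<theta>)"

definition gauss_curvature :: "surface_map \<Rightarrow> surface_map \<Rightarrow> real \<Rightarrow> real \<Rightarrow> real" where
  "gauss_curvature X U s \<theta> = det (shape_matrix X U s \<theta>)"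

definition mean_curvature :: "surface_map \<Rightarrow> surface_map \<Rightarrow> real \<Rightarrow> real \<Rightarrow> real" where
  "mean_curvature X U s \<theta> = trace (shape_matrix X U s \<theta>) / 2"

text \<open>Real powers, where negative bases are allowed for integer exponents only
  (\<^const>\<open>powr\<close> alone would use \<open>\<bar>x\<bar>\<close> for negative \<open>x\<close>).\<close>

definition rpow_defined :: "real \<Rightarrow> real \<Rightarrow> bool" where
  "rpow_defined x a \<longleftrightarrow> x > 0 \<or> (x < 0 \<and> a \<in> \<int>)"

definition rpow :: "real \<Rightarrow> real \<Rightarrow> real" where
  "rpow x a = (if a \<in> \<int> then x powi \<lfloor>a\<rfloor> else x powr a)"

definition K_translator :: "real \<Rightarrow> real^3 \<Rightarrow> real set \<Rightarrow> surface_map \<Rightarrow> surface_map \<Rightarrow> bool" where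
  "K_translator \<alpha> w I X U \<longleftrightarrow> (\<forall>s\<in>I. \<forall>\<theta>\<in>{0..<2*pi}.
     gauss_curvature X U s \<theta> \<noteq> 0 \<and>
     rpow_defined (gauss_curvature X U s \<theta>) \<alpha> \<and>
     rpow (gauss_curvature X U s \<theta>) \<alpha> = U s \<theta> \<bullet> w)"

definition rev_surface :: "(real \<Rightarrow> real) \<Rightarrow> (real \<Rightarrow> real) \<Rightarrow> surface_map" where
  "rev_surface r \<phi> s \<theta> = vector
     [r s * sin (\<phi> s) * cos \<theta>, r s * sin (\<phi> s) * sin \<theta>, r s * cos (\<phi> s) + s]"

definition rev_normal :: "(real \<Rightarrow> real) \<Rightarrow> surface_map" where
  "rev_normal \<phi> s \<theta> = vector [sin (\<phi> s) * cos \<theta>, sin (\<phi> s) * sin \<theta>, cos (\<phi> s)]"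

definition parallel_surface :: "real \<Rightarrow> surface_map \<Rightarrow> surface_map \<Rightarrow> surface_map" where
  "parallel_surface l X U s \<theta> = X s \<theta> + l *\<^sub>R U s \<theta>"

definition parallel_normal :: "real \<Rightarrow> surface_map \<Rightarrow> surface_map \<Rightarrow> surface_map" where
  "parallel_normal l X U s \<theta> =
     sgn (1 - 2 * l * mean_curvature X U s \<theta> + l\<^sup>2 * gauss_curvature X U s \<theta>) *\<^sub>R U s \<theta>"

end

theory Submission
  imports Defs "HOL-Computational_Algebra.Polynomial"
begin

text \<open>
  Write \<open>U\<close> for the normal, \<open>T = meridian_dir\<close> for its derivative in the direction of the profile
  angle and \<open>E = circle_dir\<close> for the direction of the parallel circles. The condition
  \<open>r' = - cos \<phi>\<close> gives \<open>X\<^sub>s = (r \<phi>' - sin \<phi>) T\<close> and \<open>X\<^sub>\<theta> = r sin \<phi> E\<close>, while \<open>U\<^sub>s = \<phi>' T\<close> and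
  \<open>U\<^sub>\<theta> = sin \<phi> E\<close>. So the coordinate lines are lines of curvature and
  \<open>K = \<phi>' / (r (r \<phi>' - sin \<phi>))\<close>. Passing to the parallel surface only replaces \<open>r\<close> by \<open>r + l\<close>
  (lemma \<open>parallel_surface_rev\<close>), and leaves \<open>r'\<close> and \<open>\<phi>\<close> unchanged.

  The two translator equations say that \<open>K\<close> and the curvature \<open>K / q\<close> of the parallel surface, with
  \<open>q = 1 - 2 l H + l\<^sup>2 K\<close>, have \<open>\<alpha>\<close>-th powers of the same absolute value \<open>\<bar>cos \<phi>\<bar>\<close>. As
  \<open>\<alpha> \<noteq> 0\<close>, this forces \<open>\<bar>q\<bar> = 1\<close>, and by continuity \<open>q\<close> is constantly \<open>1\<close> or constantly \<open>-1\<close>. In both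
  cases \<open>q = \<plusminus>1\<close> is a linear equation for \<open>\<phi>'\<close>, so \<open>r' = - cos \<phi>\<close> and this equation form an
  autonomous system for \<open>(r, \<phi>)\<close>, and \<open>K\<close> becomes a rational function of \<open>r\<close>. The relation
  \<open>\<bar>cos \<phi>\<bar> = \<bar>K\<bar> powr \<alpha>\<close> would have to be preserved along a solution. Its logarithmic
  derivative turns the real power into an algebraic relation, which the system does not
  preserve:

  \<^item> for \<open>q = 1\<close>, differentiating this relation once more forces \<open>cos\<^sup>2 \<phi>\<close> to be constant, which
    contradicts \<open>\<phi>' sin \<phi> cos \<phi> \<noteq> 0\<close> (lemma \<open>no_profile_with_equal_curvatures\<close>);
  \<^item> for \<open>q = -1\<close>, the system has a first integral, which eliminates \<open>\<phi>\<close> and leaves a cubic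
    equation, with leading coefficient \<open>\<alpha>\<close>, for the nonconstant function \<open>(2 r + l)\<^sup>2\<close>
    (lemma \<open>no_profile_with_opposite_curvatures\<close>).
\<close>

section \<open>Calculus on an interval\<close>

lemma nonzero_continuous_has_constant_sgn:
  fixes q :: "real \<Rightarrow> real"
  assumes "continuous_on I q" "is_interval I" "\<And>s. s \<in> I \<Longrightarrow> q s \<noteq> 0"
  obtains e where "e = 1 \<or> e = -1" "\<And>s. s \<in> I \<Longrightarrow> sgn (q s) = e"
proof -
  have iv: "is_interval (q ` I)"
    using assms by (simp add: is_interval_connected_1 connected_continuous_image)
  have "0 \<notin> q ` I"
    using assms(3) by force
  then have "\<not> (q s < 0 \<and> 0 < q t)" if "s \<in> I" "t \<in> I" for s t
    using mem_is_interval_1_I[OF iv, of "q s" "q t" 0] that by auto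
  then have "(\<forall>s\<in>I. q s > 0) \<or> (\<forall>s\<in>I. q s < 0)"
    using assms(3) by (metis linorder_neqE_linordered_idom)
  then show ?thesis
    using that[of 1] that[of "-1"] by auto
qed

lemma deriv_unique_on_open:
  fixes f g :: "real \<Rightarrow> real"
  assumes "open I" "s \<in> I" "\<And>t. t \<in> I \<Longrightarrow> f t = g t"
    and "(f has_real_derivative a) (at s)" "(g has_real_derivative b) (at s)"
  shows "a = b"
proof -
  have "(g has_real_derivative a) (at s)"
    by (rule has_field_derivative_transform_within_open[OF assms(4,1,2)]) (use assms(3) in auto)
  then show ?thesis
    using assms(5) DERIV_unique by blast
qed

text \<open>The logarithmic derivative of a power law is free of the power itself; cleared of
  denominators, it is the form in which the translator equation is used.\<close>

lemma logarithmic_differentiation: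
  fixes f g :: "real \<Rightarrow> real"
  assumes "open I" "s \<in> I"
    and "\<And>t. t \<in> I \<Longrightarrow> g t \<noteq> 0" "\<And>t. t \<in> I \<Longrightarrow> \<bar>f t\<bar> = \<bar>g t\<bar> powr a"
    and "(f has_real_derivative f') (at s)" "(g has_real_derivative g') (at s)"
  shows "f' * g s = a * g' * f s"
proof -
  have nz: "f t \<noteq> 0" if "t \<in> I" for t
    using assms(3,4)[OF that] by auto
  \<comment> \<open>Squares replace absolute values, because the logarithm of a square is differentiable
    by the standard rules whatever the sign of the base.\<close>
  have eq: "ln ((f t)\<^sup>2) = a * ln ((g t)\<^sup>2)" if "t \<in> I" for t
  proof -
    have "ln ((f t)\<^sup>2) = 2 * ln \<bar>f t\<bar>"
      using nz[OF that] by (metis ln_realpow of_nat_numeral power2_abs zero_less_abs_iff)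
    moreover have "ln ((g t)\<^sup>2) = 2 * ln \<bar>g t\<bar>"
      using assms(3)[OF that] by (metis ln_realpow of_nat_numeral power2_abs zero_less_abs_iff)
    ultimately show ?thesis
      using assms(3,4)[OF that] by (simp add: ln_powr)
  qed
  have "((\<lambda>t. ln ((f t)\<^sup>2)) has_real_derivative 2 * f' / f s) (at s)"
    using nz[OF assms(2)]
    by (auto intro!: derivative_eq_intros assms(5) simp: power2_eq_square field_simps zero_less_mult_iff linorder_neq_iff)
  moreover have "((\<lambda>t. a * ln ((g t)\<^sup>2)) has_real_derivative a * (2 * g' / g s)) (at s)"
    using assms(3)[OF assms(2)]
    by (auto intro!: derivative_eq_intros assms(6) simp: power2_eq_square field_simps zero_less_mult_iff linorder_neq_iff)
  ultimately have "2 * f' / f s = a * (2 * g' / g s)"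
    using deriv_unique_on_open[OF assms(1,2), of "\<lambda>t. ln ((f t)\<^sup>2)" "\<lambda>t. a * ln ((g t)\<^sup>2)"] eq by blast
  then show ?thesis
    using nz[OF assms(2)] assms(3)[OF assms(2)] by (simp add: field_simps)
qed

text \<open>A function on an interval whose values are roots of a nonzero polynomial takes finitely many
  values, hence is constant if it is continuous.\<close>

lemma poly_zero_along_nonconstant_curve:
  fixes W :: "real \<Rightarrow> real"
  assumes "open I" "is_interval I" "s \<in> I"
    and "\<And>t. t \<in> I \<Longrightarrow> (W has_real_derivative W' t) (at t)" "W' s \<noteq> 0"
    and "\<And>t. t \<in> I \<Longrightarrow> poly p (W t) = 0"
  shows "p = 0"
proof (rule ccontr)
  assume "p \<noteq> 0"
  then have "finite (W ` I)"
    using poly_roots_finite[of p] assms(6) by (auto intro: finite_subset[rotated])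
  moreover have "continuous_on I W"
    using assms(4) DERIV_isCont continuous_at_imp_continuous_on by blast
  moreover have "connected I"
    using assms(2) by (simp add: is_interval_connected_1)
  ultimately have "\<exists>c. W ` I = {c}"
    using connected_finite_iff_sing[of "W ` I"] connected_continuous_image[of I W] assms(3) by auto
  then obtain c where "\<And>t. t \<in> I \<Longrightarrow> W t = c"
    by auto
  then have "W' s = 0"
    using deriv_unique_on_open[OF assms(1,3) _ assms(4)[OF assms(3)], of "\<lambda>_. c" 0] by simp
  then show False
    using assms(5) by simp
qed

lemma abs_rpow_eq_powr:
  assumes "rpow_defined x a"
  shows "\<bar>rpow x a\<bar> = \<bar>x\<bar> powr a"
proof (cases "a \<in> \<int>")
  case True
  then obtain n where "a = of_int n"
    by (auto elim: Ints_cases)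
  then show ?thesis
    using assms by (auto simp: rpow_defined_def rpow_def power_int_abs powr_real_of_int')
next
  case False
  then show ?thesis
    using assms by (auto simp: rpow_defined_def rpow_def)
qed

text \<open>Since the surfaces below are rotationally symmetric about the axis \<open>w\<close>, evaluating the translator
  equation on the profile curve \<open>\<theta> = 0\<close> loses nothing. Absolute values make \<^const>\<open>powr\<close> and its
  laws applicable to integer powers of negative curvatures as well.\<close>

lemma K_translator_abs:
  assumes "K_translator a w I X N" "s \<in> I"
  shows "gauss_curvature X N s 0 \<noteq> 0" "\<bar>gauss_curvature X N s 0\<bar> powr a = \<bar>N s 0 \<bullet> w\<bar>"
proof -
  have "0 \<in> {0..<2 * pi}"
    by simp
  with assms show "gauss_curvature X N s 0 \<noteq> 0"
      "\<bar>gauss_curvature X N s 0\<bar> powr a = \<bar>N s 0 \<bullet> w\<bar>"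
    unfolding K_translator_def by (metis abs_rpow_eq_powr)+
qed

section \<open>Curvature of the surface of revolution\<close>

definition meridian_dir :: "real \<Rightarrow> real \<Rightarrow> real^3" where
  "meridian_dir a \<theta> = vector [cos a * cos \<theta>, cos a * sin \<theta>, - sin a]"

definition circle_dir :: "real \<Rightarrow> real^3" where
  "circle_dir \<theta> = vector [- sin \<theta>, cos \<theta>, 0]"

lemma has_vector_derivative_vector_3:
  assumes "(f has_real_derivative a) (at s)" "(g has_real_derivative b) (at s)"
    "(h has_real_derivative c) (at s)"
  shows "((\<lambda>t. vector [f t, g t, h t] :: real^3) has_vector_derivative vector [a, b, c]) (at s)"
proof -
  have v: "(vector [x, y, z] :: real^3) =
      x *\<^sub>R vector [1, 0, 0] + y *\<^sub>R vector [0, 1, 0] + z *\<^sub>R vector [0, 0, 1]" for x y z :: real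
    by (simp add: vec_eq_iff forall_3)
  show ?thesis
    unfolding v[of "f _"] v[of a]
    by (intro has_vector_derivative_add)
      (auto intro!: derivative_eq_intros assms simp: has_real_derivative_iff_has_vector_derivative[symmetric])
qed

lemma cross3_frame: "cross3 (meridian_dir a \<theta>) (circle_dir \<theta>) \<noteq> 0"
proof -
  have "cos \<theta> * (cos \<theta> * cos a) + cos a * (sin \<theta> * sin \<theta>) = cos a"
    using sin_cos_squared_add3[of \<theta>] by algebra
  then have "cross3 (meridian_dir a \<theta>) (circle_dir \<theta>) =
      vector [sin a * cos \<theta>, sin a * sin \<theta>, cos a]"
    by (simp add: cross3_def meridian_dir_def circle_dir_def vec_eq_iff forall_3 algebra_simps)
  also have "\<dots> \<noteq> 0"
    using sin_zero_abs_cos_one[of a] sin_zero_abs_cos_one[of \<theta>] by (auto simp: vec_eq_iff forall_3)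
  finally show ?thesis .
qed

text \<open>The axis direction is \<open>cos \<phi> U - sin \<phi> T\<close>, so in \<open>X\<^sub>s = r' U + r \<phi>' T + (0, 0, 1)\<close> the condition
  \<open>r' = - cos \<phi>\<close> is exactly what cancels the normal component.\<close>

lemma partial_s_rev_surface:
  assumes "(r has_real_derivative - cos (\<phi> s)) (at s)" "(\<phi> has_real_derivative p) (at s)"
  shows "partial_s (rev_surface r \<phi>) s \<theta> = (r s * p - sin (\<phi> s)) *\<^sub>R meridian_dir (\<phi> s) \<theta>"
proof -
  have "((\<lambda>t. rev_surface r \<phi> t \<theta>) has_vector_derivative
      vector [(r s * p - sin (\<phi> s)) * (cos (\<phi> s) * cos \<theta>),
        (r s * p - sin (\<phi> s)) * (cos (\<phi> s) * sin \<theta>),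
        (r s * p - sin (\<phi> s)) * - sin (\<phi> s)]) (at s)"
    unfolding rev_surface_def
    using sin_cos_squared_add3[of "\<phi> s"]
    by (intro has_vector_derivative_vector_3)
      (auto intro!: derivative_eq_intros assms simp: algebra_simps)
  then show ?thesis
    unfolding partial_s_def
    by (auto simp: meridian_dir_def vec_eq_iff forall_3 dest!: vector_derivative_at)
qed

lemma partial_\<theta>_rev_surface:
  "partial_\<theta> (rev_surface r \<phi>) s \<theta> = (r s * sin (\<phi> s)) *\<^sub>R circle_dir \<theta>"
proof -
  have "((\<lambda>t. rev_surface r \<phi> s t) has_vector_derivative
      vector [r s * sin (\<phi> s) * - sin \<theta>, r s * sin (\<phi> s) * cos \<theta>, 0]) (at \<theta>)"
    unfolding rev_surface_def
    by (rule has_vector_derivative_vector_3) (auto intro!: derivative_eq_intros)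
  then show ?thesis
    unfolding partial_\<theta>_def
    by (auto simp: circle_dir_def vec_eq_iff forall_3 dest!: vector_derivative_at)
qed

text \<open>The normal of a parallel surface is the original one up to a sign \<open>e\<close> that is the same at
  all points of the interval, so the sign survives differentiation as a constant factor.\<close>

lemma partial_s_signed_normal:
  assumes "open I" "s \<in> I" "(\<phi> has_real_derivative p) (at s)"
    and "\<And>t \<theta>. t \<in> I \<Longrightarrow> N t \<theta> = e *\<^sub>R rev_normal \<phi> t \<theta>"
  shows "partial_s N s \<theta> = (e * p) *\<^sub>R meridian_dir (\<phi> s) \<theta>"
proof -
  have "((\<lambda>t. rev_normal \<phi> t \<theta>) has_vector_derivative
      vector [p * (cos (\<phi> s) * cos \<theta>), p * (cos (\<phi> s) * sin \<theta>), p * - sin (\<phi> s)]) (at s)"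
    unfolding rev_normal_def
    by (rule has_vector_derivative_vector_3) (auto intro!: derivative_eq_intros assms)
  moreover have "vector [p * (cos (\<phi> s) * cos \<theta>), p * (cos (\<phi> s) * sin \<theta>), p * - sin (\<phi> s)]
      = p *\<^sub>R meridian_dir (\<phi> s) \<theta>"
    by (simp add: meridian_dir_def vec_eq_iff forall_3)
  ultimately have "((\<lambda>t. e *\<^sub>R rev_normal \<phi> t \<theta>) has_vector_derivative
      e *\<^sub>R (p *\<^sub>R meridian_dir (\<phi> s) \<theta>)) (at s)"
    by (auto intro!: has_vector_derivative_scaleR[THEN has_vector_derivative_eq_rhs])
  then have "((\<lambda>t. N t \<theta>) has_vector_derivative e *\<^sub>R (p *\<^sub>R meridian_dir (\<phi> s) \<theta>)) (at s)"
    by (rule has_vector_derivative_transform_within_open[OF _ assms(1,2)]) (simp add: assms(4))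
  then show ?thesis
    unfolding partial_s_def by (auto dest: vector_derivative_at)
qed

lemma partial_\<theta>_signed_normal:
  assumes "N s = (\<lambda>\<theta>. e *\<^sub>R rev_normal \<phi> s \<theta>)"
  shows "partial_\<theta> N s \<theta> = (e * sin (\<phi> s)) *\<^sub>R circle_dir \<theta>"
proof -
  have N: "(\<lambda>t. N s t) = (\<lambda>t. vector [e * sin (\<phi> s) * cos t, e * sin (\<phi> s) * sin t, e * cos (\<phi> s)])"
    by (auto simp: assms rev_normal_def vec_eq_iff forall_3)
  have "((\<lambda>t. N s t) has_vector_derivative
      vector [e * sin (\<phi> s) * - sin \<theta>, e * sin (\<phi> s) * cos \<theta>, 0]) (at \<theta>)"
    unfolding N
    by (rule has_vector_derivative_vector_3) (auto intro!: derivative_eq_intros)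
  then show ?thesis
    unfolding partial_\<theta>_def
    by (auto simp: circle_dir_def vec_eq_iff forall_3 dest!: vector_derivative_at)
qed

lemma cross3_scale:
  "cross3 (a *\<^sub>R x) (b *\<^sub>R y) = (a * b) *\<^sub>R cross3 x y"
  by (simp add: cross_mult_left cross_mult_right)

lemma regular_on_rev_surface:
  assumes "regular_on I (rev_surface r \<phi>)" "s \<in> I"
    and "(r has_real_derivative - cos (\<phi> s)) (at s)" "(\<phi> has_real_derivative p) (at s)"
  shows "r s \<noteq> 0" "sin (\<phi> s) \<noteq> 0" "r s * p \<noteq> sin (\<phi> s)"
proof -
  have "cross3 (partial_s (rev_surface r \<phi>) s 0) (partial_\<theta> (rev_surface r \<phi>) s 0) \<noteq> 0"
    using assms(1,2) by (auto simp: regular_on_def)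
  then show "r s \<noteq> 0" "sin (\<phi> s) \<noteq> 0" "r s * p \<noteq> sin (\<phi> s)"
    unfolding partial_s_rev_surface[OF assms(3,4)] partial_\<theta>_rev_surface cross3_scale
    by auto
qed

text \<open>If the coordinate lines are lines of curvature (Rodrigues' formula), the matrix of the shape
  operator is diagonal. Regularity makes the coordinate vectors independent, so that this matrix is
  the only candidate for the definite description.\<close>

lemma shape_matrix_principal:
  assumes "cross3 (partial_s X s \<theta>) (partial_\<theta> X s \<theta>) \<noteq> 0"
    and "- partial_s N s \<theta> = a *\<^sub>R partial_s X s \<theta>" "- partial_\<theta> N s \<theta> = b *\<^sub>R partial_\<theta> X s \<theta>"
  shows "shape_matrix X N s \<theta> = vector [vector [a, 0], vector [0, b]]"
proof -
  \<comment> \<open>Taking the cross product with one coordinate vector removes it from a linear relation.\<close>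
  let ?x = "partial_s X s \<theta>" and ?y = "partial_\<theta> X s \<theta>"
  have indep: "c = c' \<and> d = d'" if "c *\<^sub>R ?x + d *\<^sub>R ?y = c' *\<^sub>R ?x + d' *\<^sub>R ?y" for c d c' d'
  proof -
    have z: "(c - c') *\<^sub>R ?x + (d - d') *\<^sub>R ?y = 0"
      using that by (simp add: algebra_simps)
    have "(c - c') *\<^sub>R cross3 ?x ?y = cross3 ((c - c') *\<^sub>R ?x + (d - d') *\<^sub>R ?y) ?y"
      by (simp add: cross_add_left cross_mult_left)
    moreover have "(d - d') *\<^sub>R cross3 ?x ?y = cross3 ?x ((c - c') *\<^sub>R ?x + (d - d') *\<^sub>R ?y)"
      unfolding cross_add_right cross_mult_right by simp
    ultimately show ?thesis
      unfolding z using assms(1) by simp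
  qed
  show ?thesis
    unfolding shape_matrix_def assms(2,3)
  proof (rule the_equality)
    fix A :: "real^2^2"
    assume "a *\<^sub>R ?x = (A$1$1) *\<^sub>R ?x + (A$2$1) *\<^sub>R ?y \<and> b *\<^sub>R ?y = (A$1$2) *\<^sub>R ?x + (A$2$2) *\<^sub>R ?y"
    then have "a = A$1$1 \<and> 0 = A$2$1" "0 = A$1$2 \<and> b = A$2$2"
      using indep[of a 0] indep[of 0 b] by auto
    then show "A = vector [vector [a, 0], vector [0, b]]"
      by (simp add: vec_eq_iff forall_2)
  qed simp
qed

lemma rev_surface_curvatures:
  assumes "open I" "s \<in> I"
    and "(r has_real_derivative - cos (\<phi> s)) (at s)" "(\<phi> has_real_derivative p) (at s)"
    and "r s \<noteq> 0" "sin (\<phi> s) \<noteq> 0" "r s * p \<noteq> sin (\<phi> s)"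
    and "\<And>t \<theta>. t \<in> I \<Longrightarrow> N t \<theta> = e *\<^sub>R rev_normal \<phi> t \<theta>"
  shows "gauss_curvature (rev_surface r \<phi>) N s \<theta> = e\<^sup>2 * p / (r s * (r s * p - sin (\<phi> s)))"
    and "mean_curvature (rev_surface r \<phi>) N s \<theta> = - e * (p / (r s * p - sin (\<phi> s)) + 1 / r s) / 2"
proof -
  have "N s = (\<lambda>\<theta>. e *\<^sub>R rev_normal \<phi> s \<theta>)"
    using assms(2,8) by blast
  note N_\<theta> = partial_\<theta>_signed_normal[of N s e \<phi>, OF this]
  have shape: "shape_matrix (rev_surface r \<phi>) N s \<theta> =
      vector [vector [- e * p / (r s * p - sin (\<phi> s)), 0], vector [0, - e / r s]]"
    using assms(5-7) cross3_frame[of "\<phi> s" \<theta>]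
    by (intro shape_matrix_principal)
      (simp_all add: partial_s_rev_surface[OF assms(3,4)] partial_\<theta>_rev_surface cross3_scale
        partial_s_signed_normal[OF assms(1,2,4,8)] N_\<theta>)
  show "gauss_curvature (rev_surface r \<phi>) N s \<theta> = e\<^sup>2 * p / (r s * (r s * p - sin (\<phi> s)))"
    unfolding gauss_curvature_def shape det_2 by (simp add: power2_eq_square mult_ac)
  show "mean_curvature (rev_surface r \<phi>) N s \<theta> = - e * (p / (r s * p - sin (\<phi> s)) + 1 / r s) / 2"
    unfolding mean_curvature_def shape trace_def by (simp add: sum_2 algebra_simps add_divide_distrib)
qed

text \<open>The parametrization is \<open>r U\<close> plus a motion along the axis, so adding \<open>l U\<close> shifts \<open>r\<close>.\<close>

lemma parallel_surface_rev:
  "parallel_surface l (rev_surface r \<phi>) (rev_normal \<phi>) = rev_surface (\<lambda>s. r s + l) \<phi>"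
  by (intro ext)
    (simp add: parallel_surface_def rev_surface_def rev_normal_def vec_eq_iff forall_3 algebra_simps)

lemma rev_normal_inner_axis: "rev_normal \<phi> s \<theta> \<bullet> vector [0, 0, 1] = cos (\<phi> s)"
  by (simp add: rev_normal_def inner_vec_def sum_3)

section \<open>Profiles whose curvature is preserved up to sign\<close>

text \<open>Here \<open>ode\<close> is the equation \<open>q = 1\<close>, cleared of denominators and divided by \<open>l\<close>; along its solutions
  \<open>K = -1 / (r (r + l))\<close>.
  With \<open>C = cos\<^sup>2 \<phi>\<close>, \<open>t = r (r + l)\<close> and \<open>u = 2 r + l\<close>, the logarithmic derivative of the speed
  equation amounts to \<open>C (t - \<alpha> u\<^sup>2) = t\<close>. Both sides are again differentiated along the system; since
  \<open>u\<^sup>2 = 4 t + l\<^sup>2\<close>, all terms in \<open>t\<close> cancel and \<open>C (1 - 4 \<alpha>) = 1 + 2 \<alpha>\<close> remains.\<close>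

lemma no_profile_with_equal_curvatures:
  fixes r \<phi> p :: "real \<Rightarrow> real"
  assumes "open I" "I \<noteq> {}"
    and r: "\<And>s. s \<in> I \<Longrightarrow> (r has_real_derivative - cos (\<phi> s)) (at s)"
    and \<phi>: "\<And>s. s \<in> I \<Longrightarrow> (\<phi> has_real_derivative p s) (at s)"
    and nz: "\<And>s. s \<in> I \<Longrightarrow> r s \<noteq> 0" "\<And>s. s \<in> I \<Longrightarrow> r s + l \<noteq> 0"
    and sin: "\<And>s. s \<in> I \<Longrightarrow> sin (\<phi> s) \<noteq> 0"
    and ode: "\<And>s. s \<in> I \<Longrightarrow> (2 * r s + l) * p s = sin (\<phi> s)"
    and speed: "\<And>s. s \<in> I \<Longrightarrow> \<bar>cos (\<phi> s)\<bar> = \<bar>1 / (r s * (r s + l))\<bar> powr \<alpha>"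
  shows False
proof -
  have cos: "cos (\<phi> s) \<noteq> 0" if "s \<in> I" for s
    using speed[OF that] nz[OF that] by auto
  have first: "(cos (\<phi> s))\<^sup>2 * (r s * (r s + l) - \<alpha> * (2 * r s + l)\<^sup>2) = r s * (r s + l)"
    if "s \<in> I" for s
  proof -
    have "- sin (\<phi> s) * p s * (r s * (r s + l)) = - \<alpha> * (- cos (\<phi> s) * (2 * r s + l)) * cos (\<phi> s)"
    proof (rule logarithmic_differentiation[OF assms(1) that])
      show "\<bar>cos (\<phi> t)\<bar> = \<bar>r t * (r t + l)\<bar> powr - \<alpha>" if "t \<in> I" for t
        using speed[OF that] by (simp add: powr_divide powr_minus_divide)
      show "((\<lambda>s. r s * (r s + l)) has_real_derivative - cos (\<phi> s) * (2 * r s + l)) (at s)"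
        by (auto intro!: derivative_eq_intros r[OF that] simp: algebra_simps)
    qed (use nz in \<open>auto intro!: derivative_eq_intros \<phi>[OF that]\<close>)
    then have "- sin (\<phi> s) * ((2 * r s + l) * p s) * (r s * (r s + l)) = \<alpha> * ((2 * r s + l) * cos (\<phi> s))\<^sup>2"
      by algebra
    then have "- (sin (\<phi> s))\<^sup>2 * (r s * (r s + l)) = \<alpha> * ((2 * r s + l) * cos (\<phi> s))\<^sup>2"
      unfolding ode[OF that] by algebra
    then show ?thesis
      using sin_cos_squared_add[of "\<phi> s"] by algebra
  qed
  have second: "(cos (\<phi> s))\<^sup>2 * (1 - 4 * \<alpha>) = 1 + 2 * \<alpha>" if "s \<in> I" for s
  proof -
    let ?C = "cos (\<phi> s)" and ?S = "sin (\<phi> s)" and ?u = "2 * r s + l" and ?t = "r s * (r s + l)"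
    have "- 2 * ?C * ?S * p s * (?t - \<alpha> * ?u\<^sup>2) + ?C\<^sup>2 * (- ?C * ?u + 4 * \<alpha> * ?u * ?C) = - ?C * ?u"
      by (rule deriv_unique_on_open[OF assms(1) that first])
        (auto intro!: derivative_eq_intros r[OF that] \<phi>[OF that] simp: algebra_simps power2_eq_square)
    then have "?C * (2 * ?S * p s * (?t - \<alpha> * ?u\<^sup>2) + ?C\<^sup>2 * (?u - 4 * \<alpha> * ?u) - ?u) = 0"
      by algebra
    then have "2 * ?S * p s * (?t - \<alpha> * ?u\<^sup>2) + ?C\<^sup>2 * (?u - 4 * \<alpha> * ?u) - ?u = 0"
      using cos[OF that] by simp
    then have "2 * ?S * (?u * p s) * (?t - \<alpha> * ?u\<^sup>2) + ?u\<^sup>2 * (?C\<^sup>2 * (1 - 4 * \<alpha>) - 1) = 0"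
      by algebra
    then have "?u\<^sup>2 * (?C\<^sup>2 * (1 - 4 * \<alpha>) - (1 + 2 * \<alpha>)) = 0"
      unfolding ode[OF that] using first[OF that] sin_cos_squared_add[of "\<phi> s"] by algebra
    moreover have "?u \<noteq> 0"
      using ode[OF that] sin[OF that] by auto
    ultimately show ?thesis
      by simp
  qed
  obtain s where s: "s \<in> I"
    using assms(2) by auto
  have "\<alpha> \<noteq> 1 / 4"
  proof
    assume "\<alpha> = 1 / 4"
    then show False
      using second[OF s] by algebra
  qed
  have "- 2 * cos (\<phi> s) * sin (\<phi> s) * p s * (1 - 4 * \<alpha>) = 0"
    by (rule deriv_unique_on_open[OF assms(1) s second])
      (auto intro!: derivative_eq_intros \<phi>[OF s])
  then show False
    using cos[OF s] sin[OF s] ode[OF s] \<open>\<alpha> \<noteq> 1 / 4\<close> by auto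
qed

text \<open>Here \<open>ode\<close> is the equation \<open>q = -1\<close> cleared of denominators, and along its solutions
  \<open>K = - (2 r + l) / (l r (r + l))\<close>. In terms of \<open>u = 2 r + l\<close>, which has \<open>u' = -2 cos \<phi>\<close>, it reads
  \<open>(u\<^sup>2 + l\<^sup>2) \<phi>' = 2 u sin \<phi>\<close>. This has the first integral \<open>sin\<^sup>2 \<phi> (u\<^sup>2 + l\<^sup>2) = c\<close>, which is used
  to express \<open>cos\<^sup>2 \<phi>\<close> by \<open>W = u\<^sup>2\<close> in the logarithmic derivative of the speed equation. As
  \<open>4 r (r + l) = W - l\<^sup>2\<close>, the outcome is a polynomial equation for \<open>W\<close> alone.\<close>

lemma no_profile_with_opposite_curvatures:
  fixes r \<phi> p :: "real \<Rightarrow> real"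
  assumes "open I" "is_interval I" "I \<noteq> {}" "\<alpha> \<noteq> 0" "l \<noteq> 0"
    and r: "\<And>s. s \<in> I \<Longrightarrow> (r has_real_derivative - cos (\<phi> s)) (at s)"
    and \<phi>: "\<And>s. s \<in> I \<Longrightarrow> (\<phi> has_real_derivative p s) (at s)"
    and nz: "\<And>s. s \<in> I \<Longrightarrow> r s \<noteq> 0" "\<And>s. s \<in> I \<Longrightarrow> r s + l \<noteq> 0" "\<And>s. s \<in> I \<Longrightarrow> 2 * r s + l \<noteq> 0"
    and ode: "\<And>s. s \<in> I \<Longrightarrow> ((r s)\<^sup>2 + (r s + l)\<^sup>2) * p s = (2 * r s + l) * sin (\<phi> s)"
    and speed: "\<And>s. s \<in> I \<Longrightarrow> \<bar>cos (\<phi> s)\<bar> = \<bar>(2 * r s + l) / (l * (r s * (r s + l)))\<bar> powr \<alpha>"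
  shows False
proof -
  have cos: "cos (\<phi> s) \<noteq> 0" if "s \<in> I" for s
    using speed[OF that] nz[OF that] assms(5) by auto
  define W where "W s = (2 * r s + l)\<^sup>2" for s
  have W: "(W has_real_derivative - 4 * (2 * r s + l) * cos (\<phi> s)) (at s)" if "s \<in> I" for s
    unfolding W_def by (auto intro!: derivative_eq_intros r[OF that] simp: algebra_simps)
  have ode': "(W s + l\<^sup>2) * p s = 2 * (2 * r s + l) * sin (\<phi> s)" if "s \<in> I" for s
    unfolding W_def using ode[OF that] by algebra
  have "\<exists>c. \<forall>s\<in>I. (sin (\<phi> s))\<^sup>2 * (W s + l\<^sup>2) = c"
  proof (rule has_field_derivative_zero_constant)
    show "convex I"
      using assms(2) by (simp add: is_interval_convex_1)
    fix s assume s: "s \<in> I"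
    have "((\<lambda>s. (sin (\<phi> s))\<^sup>2 * (W s + l\<^sup>2)) has_real_derivative
        2 * sin (\<phi> s) * cos (\<phi> s) * ((W s + l\<^sup>2) * p s) +
        (sin (\<phi> s))\<^sup>2 * (- 4 * (2 * r s + l) * cos (\<phi> s))) (at s)"
      by (auto intro!: derivative_eq_intros W[OF s] \<phi>[OF s] simp: power2_eq_square algebra_simps)
    then show "((\<lambda>s. (sin (\<phi> s))\<^sup>2 * (W s + l\<^sup>2)) has_real_derivative 0) (at s within I)"
      unfolding ode'[OF s] by (simp add: power2_eq_square algebra_simps has_field_derivative_at_within)
  qed
  then obtain c where c: "\<And>s. s \<in> I \<Longrightarrow> (sin (\<phi> s))\<^sup>2 * (W s + l\<^sup>2) = c"
    by auto
  have cubic: "W s * (W s - l\<^sup>2) * c + \<alpha> * (W s + l\<^sup>2)\<^sup>2 * (W s + l\<^sup>2 - c) = 0" if "s \<in> I" for s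
  proof -
    let ?C = "cos (\<phi> s)" and ?S = "sin (\<phi> s)" and ?u = "2 * r s + l" and ?t = "r s * (r s + l)"
    have clear: "x * u * d = y * C" if "x * (u / d) = \<alpha> * (n / d\<^sup>2) * C" "d \<noteq> 0" "y = \<alpha> * n"
      for x u d y n C :: real
      using that by (simp add: field_simps power2_eq_square)
    have nzt: "l * ?t \<noteq> 0"
      using nz[OF that] assms(5) by auto
    have "- ?S * p s * (?u / (l * ?t)) =
        \<alpha> * ((- 2 * ?C * (l * ?t) + ?u * (l * (?C * ?u))) / (l * ?t)\<^sup>2) * ?C"
    proof (rule logarithmic_differentiation[OF assms(1) that, where f = "\<lambda>s. cos (\<phi> s)"
          and g = "\<lambda>s. (2 * r s + l) / (l * (r s * (r s + l)))"])
      show "((\<lambda>s. (2 * r s + l) / (l * (r s * (r s + l)))) has_real_derivative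
          (- 2 * ?C * (l * ?t) + ?u * (l * (?C * ?u))) / (l * ?t)\<^sup>2) (at s)"
        using nzt by (auto intro!: derivative_eq_intros r[OF that] simp: power2_eq_square algebra_simps)
    qed (use nz assms(5) speed \<phi>[OF that] in \<open>auto intro!: derivative_eq_intros\<close>)
    then have "- ?S * p s * ?u * (l * ?t) = \<alpha> * (- 2 * ?C * (l * ?t) + ?u * (l * (?C * ?u))) * ?C"
      using clear[OF _ nzt, of "- ?S * p s" ?u] by simp
    then have "l * (- ?S * p s * ?u * ?t - \<alpha> * (- 2 * ?C * ?t + ?u * (?C * ?u)) * ?C) = 0"
      by algebra
    then have "- ?S * p s * ?u * ?t = \<alpha> * (- 2 * ?C * ?t + ?u * (?C * ?u)) * ?C"
      using assms(5) by simp
    then have "- 2 * ?S * p s * ?u * (W s - l\<^sup>2) = 4 * \<alpha> * (W s + l\<^sup>2) * ?C\<^sup>2"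
      unfolding W_def by algebra
    then have "- 2 * ?S * ((W s + l\<^sup>2) * p s) * ?u * (W s - l\<^sup>2) = 4 * \<alpha> * (W s + l\<^sup>2)\<^sup>2 * ?C\<^sup>2"
      by algebra
    then have "- ?S\<^sup>2 * W s * (W s - l\<^sup>2) = \<alpha> * (W s + l\<^sup>2)\<^sup>2 * ?C\<^sup>2"
      unfolding ode'[OF that] unfolding W_def by algebra
    then show ?thesis
      using c[OF that] sin_cos_squared_add[of "\<phi> s"] by algebra
  qed
  let ?L = "l\<^sup>2"
  let ?P = "smult c ([:0, 1:] * [:- ?L, 1:]) + smult \<alpha> ([:?L, 1:]\<^sup>2 * [:?L - c, 1:])"
  obtain s where s: "s \<in> I"
    using assms(3) by auto
  have "?P = 0"
  proof (rule poly_zero_along_nonconstant_curve[OF assms(1,2) s W])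
    show "- 4 * (2 * r s + l) * cos (\<phi> s) \<noteq> 0"
      using nz[OF s] cos[OF s] by simp
    show "poly ?P (W t) = 0" if "t \<in> I" for t
      using cubic[OF that] by (simp add: power2_eq_square algebra_simps)
  qed
  \<comment> \<open>Only the second summand of \<open>?P\<close> has degree 3, and its leading coefficient is \<open>\<alpha>\<close>.\<close>
  then have "coeff ?P 3 = 0"
    by simp
  then show False
    using assms(4) by (simp add: power2_eq_square numeral_3_eq_3)
qed

theorem corollary6:
  fixes \<alpha> :: real and I :: "real set" and r \<phi> :: "real \<Rightarrow> real"
    and w :: "real^3" and X U :: surface_map
  defines "w \<equiv> vector [0, 0, 1]"
    and "X \<equiv> rev_surface r \<phi>"
    and "U \<equiv> rev_normal \<phi>"
  assumes "\<alpha> \<noteq> 0"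
    and "open I" "is_interval I" "I \<noteq> {}"
    and "smooth_fun_on I r" "smooth_fun_on I \<phi>"
    and "\<And>s. s \<in> I \<Longrightarrow> r s > 0"
    and "\<And>s. s \<in> I \<Longrightarrow> deriv r s = - cos (\<phi> s)"
    and "regular_on I X"
    and "K_translator \<alpha> w I X U"
  shows "\<not> (\<exists>l. l \<noteq> 0 \<and> regular_on I (parallel_surface l X U) \<and>
    K_translator \<alpha> w I (parallel_surface l X U) (parallel_normal l X U))"
proof (intro notI, elim exE conjE)
  fix l :: real
  let ?N = "parallel_normal l X U" and ?\<rho> = "\<lambda>s. r s + l" and ?p = "deriv \<phi>"
  assume "l \<noteq> 0" and regular: "regular_on I (parallel_surface l X U)"
    and translator: "K_translator \<alpha> w I (parallel_surface l X U) ?N"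
  have parallel: "parallel_surface l X U = rev_surface ?\<rho> \<phi>"
    unfolding X_def U_def by (rule parallel_surface_rev)
  have diff: "r differentiable (at s)" "\<phi> differentiable (at s)" "?p differentiable (at s)"
    if "s \<in> I" for s
    using assms(8,9) that unfolding smooth_fun_on_def
    by (metis funpow_0, metis funpow_0, metis funpow_0 funpow.simps(2) comp_apply)
  have r: "(r has_real_derivative - cos (\<phi> s)) (at s)" if "s \<in> I" for s
    using diff(1)[OF that] assms(11)[OF that] by (metis DERIV_deriv_iff_real_differentiable)
  have \<phi>: "(\<phi> has_real_derivative ?p s) (at s)" if "s \<in> I" for s
    using diff(2)[OF that] by (simp add: DERIV_deriv_iff_real_differentiable)
  have \<rho>: "(?\<rho> has_real_derivative - cos (\<phi> s)) (at s)" if "s \<in> I" for s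
    using r[OF that] by (auto intro!: derivative_eq_intros)
  note nz = regular_on_rev_surface[OF assms(12)[unfolded X_def] _ r \<phi>]
  note nz' = regular_on_rev_surface[OF regular[unfolded parallel] _ \<rho> \<phi>]
  \<comment> \<open>The factor \<open>1 - 2 l H + l\<^sup>2 K\<close>, written as the quotient of the signed area elements of the parallel
    surface and of the surface; in this form regularity shows that it does not vanish.\<close>
  define q where
    "q s = ?\<rho> s * (?\<rho> s * ?p s - sin (\<phi> s)) / (r s * (r s * ?p s - sin (\<phi> s)))" for s
  have K: "gauss_curvature X U s \<theta> = ?p s / (r s * (r s * ?p s - sin (\<phi> s)))"
    and H: "mean_curvature X U s \<theta> = - (?p s / (r s * ?p s - sin (\<phi> s)) + 1 / r s) / 2"
    if "s \<in> I" for s \<theta>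
    using rev_surface_curvatures[OF assms(5) that r[OF that] \<phi>[OF that] nz[OF that that that],
        where e = 1 and N = U] unfolding X_def U_def by simp_all
  have qKH: "1 - 2 * l * mean_curvature X U s \<theta> + l\<^sup>2 * gauss_curvature X U s \<theta> = q s"
    if "s \<in> I" for s \<theta>
  proof -
    have factor: "1 - 2 * l * (- (a / b + 1 / x) / 2) + l\<^sup>2 * (a / (x * b)) =
        (x + l) * ((x + l) * a - S) / (x * b)"
      if "b = x * a - S" "b \<noteq> 0" "x \<noteq> 0" for a b S x :: real
    proof -
      have S: "S = x * a - b"
        using that(1) by simp
      show ?thesis
        unfolding S using that(2,3) by (simp add: field_simps power2_eq_square)
    qed
    show ?thesis
      unfolding K[OF that] H[OF that] q_def
      by (rule factor) (use nz[OF that that that] in auto)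
  qed
  obtain e where e: "e = 1 \<or> e = -1" "\<And>s. s \<in> I \<Longrightarrow> sgn (q s) = e"
  proof (rule nonzero_continuous_has_constant_sgn[of I q])
    have "continuous_on I r" "continuous_on I \<phi>" "continuous_on I ?p"
      using diff by (auto intro!: continuous_at_imp_continuous_on differentiable_imp_continuous_within)
    then show "continuous_on I q"
      unfolding q_def using nz by (auto intro!: continuous_intros)
    show "q s \<noteq> 0" if "s \<in> I" for s
      unfolding q_def using nz[OF that that that] nz'[OF that that that] by simp
  qed (use assms(6) in auto)
  have N: "?N s \<theta> = e *\<^sub>R rev_normal \<phi> s \<theta>" if "s \<in> I" for s \<theta>
    using qKH[OF that] e(2)[OF that] by (simp add: parallel_normal_def U_def)
  have K': "gauss_curvature (parallel_surface l X U) ?N s \<theta> =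
      ?p s / (?\<rho> s * (?\<rho> s * ?p s - sin (\<phi> s)))" if "s \<in> I" for s \<theta>
    using rev_surface_curvatures(1)[OF assms(5) that \<rho>[OF that] \<phi>[OF that] nz'[OF that that that] N] e(1)
    unfolding parallel by auto
  define k where "k s = ?p s / (r s * (r s * ?p s - sin (\<phi> s)))" for s
  have k: "k s \<noteq> 0" "\<bar>k s\<bar> powr \<alpha> = \<bar>cos (\<phi> s)\<bar>" if "s \<in> I" for s
    using K_translator_abs[OF assms(13) that]
    unfolding K[OF that] k_def[symmetric] by (simp_all add: U_def w_def rev_normal_inner_axis)
  have q: "q s = e" if "s \<in> I" for s
  proof -
    let ?k' = "?p s / (?\<rho> s * (?\<rho> s * ?p s - sin (\<phi> s)))"
    have "\<bar>?k'\<bar> powr \<alpha> = \<bar>e * cos (\<phi> s)\<bar>"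
      using K_translator_abs(2)[OF translator that]
      unfolding K'[OF that] N[OF that] by (simp add: w_def rev_normal_inner_axis)
    then have "\<bar>?k'\<bar> powr \<alpha> = \<bar>k s\<bar> powr \<alpha>"
      using k(2)[OF that] e(1) by (auto simp: abs_mult)
    then have "(\<bar>?k'\<bar> powr \<alpha>) powr (1 / \<alpha>) = (\<bar>k s\<bar> powr \<alpha>) powr (1 / \<alpha>)"
      by simp
    then have "\<bar>?k'\<bar> = \<bar>k s\<bar>"
      using assms(4) by (simp add: powr_powr)
    moreover have "k s = q s * ?k'"
      unfolding k_def q_def using nz'[OF that that that] by simp
    ultimately have "\<bar>q s\<bar> = 1"
      using k(1)[OF that] by (auto simp: abs_mult)
    then show ?thesis
      using e(2)[OF that] by (auto simp: abs_if sgn_if split: if_splits)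
  qed
  have qe: "?\<rho> s * (?\<rho> s * ?p s - sin (\<phi> s)) = e * (r s * (r s * ?p s - sin (\<phi> s)))" if "s \<in> I" for s
    using q[OF that] nz[OF that that that] by (simp add: q_def divide_simps)
  show False
    using e(1)
  proof
    assume "e = 1"
    have ode: "(2 * r s + l) * ?p s = sin (\<phi> s)" if "s \<in> I" for s
    proof -
      have "l * ((2 * r s + l) * ?p s - sin (\<phi> s)) = 0"
        using qe[OF that] unfolding \<open>e = 1\<close> by algebra
      then show ?thesis
        using \<open>l \<noteq> 0\<close> by simp
    qed
    have "\<bar>k s\<bar> = \<bar>1 / (r s * (r s + l))\<bar>" if "s \<in> I" for s
    proof -
      have "r s * ?p s - sin (\<phi> s) = - (r s + l) * ?p s"
        unfolding ode[OF that, symmetric] by (simp add: algebra_simps)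
      moreover have p0: "?p s \<noteq> 0"
        using k(1)[OF that] by (auto simp: k_def)
      ultimately have "k s = ?p s / (r s * (- (r s + l) * ?p s))"
        unfolding k_def by simp
      also have "\<dots> = - (1 / (r s * (r s + l)))"
        using p0 nz(1)[OF that that that] nz'(1)[OF that that that] by (simp add: divide_simps)
      finally show ?thesis
        by simp
    qed
    with k(2) show False
      by (intro no_profile_with_equal_curvatures[OF assms(5,7) r \<phi> _ _ _ ode, of \<alpha>] nz(1,2) nz'(1)) auto
  next
    assume "e = -1"
    have ode: "((r s)\<^sup>2 + (r s + l)\<^sup>2) * ?p s = (2 * r s + l) * sin (\<phi> s)" if "s \<in> I" for s
      using qe[OF that] unfolding \<open>e = -1\<close> by algebra
    \<comment> \<open>Where \<open>2 r + l\<close> vanishes, the equation forces \<open>\<phi>' = 0\<close>, that is, a zero of \<open>K\<close>.\<close>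
    have u: "2 * r s + l \<noteq> 0" if "s \<in> I" for s
    proof
      assume "2 * r s + l = 0"
      then have "((r s)\<^sup>2 + (r s + l)\<^sup>2) * ?p s = 0"
        using ode[OF that] by simp
      moreover have "(r s)\<^sup>2 + (r s + l)\<^sup>2 \<noteq> 0"
        using nz(1)[OF that that that] by (simp add: sum_power2_eq_zero_iff)
      ultimately show False
        using k(1)[OF that] by (simp add: k_def)
    qed
    have "\<bar>k s\<bar> = \<bar>(2 * r s + l) / (l * (r s * (r s + l)))\<bar>" if "s \<in> I" for s
    proof -
      have "(2 * r s + l) * (r s * ?p s - sin (\<phi> s)) = - l * (r s + l) * ?p s"
        using ode[OF that] by algebra
      then have "?p s * (l * (r s * (r s + l))) = - (2 * r s + l) * (r s * (r s * ?p s - sin (\<phi> s)))"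
        by algebra
      then have "k s = - (2 * r s + l) / (l * (r s * (r s + l)))"
        unfolding k_def using nz[OF that that that] nz'(1)[OF that that that] \<open>l \<noteq> 0\<close>
        by (subst frac_eq_eq) auto
      then show ?thesis
        by (simp only: abs_divide abs_minus)
    qed
    with k(2) show False
      by (intro no_profile_with_opposite_curvatures[OF assms(5,6,7,4) \<open>l \<noteq> 0\<close> r \<phi> _ _ u ode]
          nz(1) nz'(1)) auto
  qed
qed

end
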